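(* For every integer $n\ge 1$, $$\exp\biggl(\frac{1}{240n^{3}}-\frac{11}{6720n^{5}}\biggr)<\frac{e^n\,n!}{n^{n}\sqrt{2\pi n}\,\exp\bigl(\frac{1}{12}\psi'\bigl(n+\frac{1}{2}\bigr)\bigr)}<\exp\biggl(\frac{1}{240n^{3}}\biggr).$$
   Context: $\Gamma$ is Euler's gamma function, $\Gamma(x)=\int_0^\infty t^{x-1}e^{-t}\,dt$ for $x>0$; $\psi(x)=\frac{d}{dx}\ln\Gamma(x)=\Gamma'(x)/\Gamma(x)$ is the di-gamma function, and its derivative $\psi'(x)$, $x>0$, is the tri-gamma function. *)

theory Defs
  imports "HOL-Analysis.Analysis"
begin

(* The library defines Polygamma n by a series for every n; the two lemmas confirm that
   Polygamma 0 and Polygamma 1 are psi = Gamma'/Gamma and psi' on the positive reals. *)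

lemma Digamma_eq_log_deriv_Gamma:
  fixes x :: real
  assumes "x > 0"
  shows "Digamma x = deriv Gamma x / Gamma x"
proof -
  have nonpos: "x \<notin> \<int>\<^sub>\<le>\<^sub>0"
    using assms by (auto elim!: nonpos_Ints_cases)
  have "(Gamma has_field_derivative Gamma x * Digamma x) (at x)"
    using has_field_derivative_Gamma[OF nonpos] by simp
  then have "deriv Gamma x = Gamma x * Digamma x"
    by (rule DERIV_imp_deriv)
  then show ?thesis
    using Gamma_real_pos[OF assms] by simp
qed

lemma Polygamma_1_eq_deriv_Digamma:
  fixes x :: real
  assumes "x > 0"
  shows "Polygamma 1 x = deriv Digamma x"
proof -
  have nonpos: "x \<notin> \<int>\<^sub>\<le>\<^sub>0"
    using assms by (auto elim!: nonpos_Ints_cases)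
  have "(Digamma has_field_derivative Polygamma 1 x) (at x)"
    using has_field_derivative_Polygamma[OF nonpos, of 0 UNIV] by simp
  then show ?thesis
    by (simp add: DERIV_imp_deriv)
qed

end

theory Submission
  imports Defs "HOL-Real_Asymp.Real_Asymp"
begin

text \<open>
  Let \<open>F n\<close> be the logarithm of the quotient in the theorem. The recurrence of \<open>\<psi>'\<close> gives
  \<open>F n - F (n + 1) = (n + 1/2) ln (1 + 1/n) - 1 - 1/(12 (n + 1/2)\<^sup>2)\<close>, in which the power series
  of the inverse hyperbolic tangent at \<open>1/(2n + 1)\<close> leaves \<open>\<Sum>k\<ge>2. (2n + 1) powr (-2k) / (2k + 1)\<close>.
  With \<open>G n\<close> the upper and \<open>H n\<close> the lower exponent, this lies strictly between
  \<open>H n - H (n + 1)\<close> and \<open>G n - G (n + 1)\<close>. Hence \<open>F - G\<close> increases strictly and \<open>F - H\<close> decreases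
  strictly; both tend to 0 by Stirling's formula.
\<close>

section \<open>Elementary estimates for a single step from x to x + 1\<close>

text \<open>Since ln ((x + 1) / x) = 2 artanh (1 / w), the product is the series with terms 1 / ((2k
  + 1) w^(2k)), k \<ge> 0. The lower bound keeps k \<le> 3. The upper bound replaces 2k + 1 by 5 for
  k \<ge> 2 and sums the geometric series.\<close>

lemma ln_quotient_bounds:
  fixes x :: real
  assumes "x > 0"
  defines "w \<equiv> 2 * x + 1"
  shows "1 + 1 / (3 * w ^ 2) + 1 / (5 * w ^ 4) + 1 / (7 * w ^ 6) \<le> (x + 1 / 2) * (ln (x + 1) - ln x)"
    and "(x + 1 / 2) * (ln (x + 1) - ln x) \<le> 1 + 1 / (3 * w ^ 2) + 1 / (5 * w ^ 2 * (w ^ 2 - 1))"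
proof -
  have w: "w > 1" and xw: "x + 1 / 2 = w / 2"
    using assms by (simp_all add: w_def)
  have w2: "w ^ 2 > 1"
    using w by (simp add: one_less_power)
  \<comment> \<open>\<open>ln_approx_bounds\<close> expands ln a in powers of (a - 1) / (a + 1);
    here a = (x + 1) / x.\<close>
  have y: "((x + 1) / x - 1) / ((x + 1) / x + 1) = 1 / w"
    using assms(1) by (simp add: w_def field_simps)
  have ln: "ln ((x + 1) / x) = ln (x + 1) - ln x"
    using assms(1) by (simp add: ln_div)
  have gt1: "(x + 1) / x > 1"
    using assms(1) by simp
  have "2 * (1 / w) + 2 * (1 / w) ^ 3 / 3 + 2 * (1 / w) ^ 5 / 5 + 2 * (1 / w) ^ 7 / 7
      \<le> ln (x + 1) - ln x"
    using ln_approx_bounds[OF gt1, of 4] unfolding y ln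
    by (simp add: eval_nat_numeral field_simps)
  then have "(x + 1 / 2) * (2 * (1 / w) + 2 * (1 / w) ^ 3 / 3 + 2 * (1 / w) ^ 5 / 5 + 2 * (1 / w) ^ 7 / 7)
      \<le> (x + 1 / 2) * (ln (x + 1) - ln x)"
    using assms(1) by (intro mult_left_mono) auto
  moreover have "(x + 1 / 2) * (2 * (1 / w) + 2 * (1 / w) ^ 3 / 3 + 2 * (1 / w) ^ 5 / 5 + 2 * (1 / w) ^ 7 / 7)
      = 1 + 1 / (3 * w ^ 2) + 1 / (5 * w ^ 4) + 1 / (7 * w ^ 6)"
    unfolding xw using w by (simp add: field_simps eval_nat_numeral)
  ultimately show "1 + 1 / (3 * w ^ 2) + 1 / (5 * w ^ 4) + 1 / (7 * w ^ 6) \<le> (x + 1 / 2) * (ln (x + 1) - ln x)"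
    by simp
  have "ln (x + 1) - ln x
      \<le> 2 * (1 / w) + 2 * (1 / w) ^ 3 / 3 + 2 * ((1 / w) ^ 5 / (1 - (1 / w) ^ 2) / 5)"
    using ln_approx_bounds[OF gt1, of 2] unfolding y ln
    by (simp add: eval_nat_numeral field_simps)
  then have "(x + 1 / 2) * (ln (x + 1) - ln x) \<le>
     (x + 1 / 2) * (2 * (1 / w) + 2 * (1 / w) ^ 3 / 3 + 2 * ((1 / w) ^ 5 / (1 - (1 / w) ^ 2) / 5))"
    using assms(1) by (intro mult_left_mono) auto
  moreover have "(1 / w) ^ 5 / (1 - (1 / w) ^ 2) = 1 / (w ^ 3 * (w ^ 2 - 1))"
    using w w2 by (simp add: field_simps eval_nat_numeral)
  then have "(x + 1 / 2) * (2 * (1 / w) + 2 * (1 / w) ^ 3 / 3 + 2 * ((1 / w) ^ 5 / (1 - (1 / w) ^ 2) / 5))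
      = 1 + 1 / (3 * w ^ 2) + 1 / (5 * w ^ 2 * (w ^ 2 - 1))"
    unfolding xw using w w2 by (simp add: divide_simps) (simp add: algebra_simps eval_nat_numeral)
  ultimately show "(x + 1 / 2) * (ln (x + 1) - ln x) \<le> 1 + 1 / (3 * w ^ 2) + 1 / (5 * w ^ 2 * (w ^ 2 - 1))"
    by simp
qed

text \<open>With v = x (x + 1) and \<open>w ^ 2 = 4 * v + 1\<close>, the numerator of the difference
  is (3v + 1)(4v + 1) - 12 v^2 = 7v + 1 > 0.\<close>

lemma cube_diff_gt:
  fixes x :: real
  assumes "x > 0"
  defines "w \<equiv> 2 * x + 1"
  shows "1 / (5 * w ^ 2 * (w ^ 2 - 1)) < 1 / (240 * x ^ 3) - 1 / (240 * (x + 1) ^ 3)"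
proof -
  have w: "w > 1" "w ^ 2 - 1 = 4 * (x * (x + 1))"
    using assms by (simp_all add: w_def algebra_simps power2_eq_square)
  have "1 / (240 * x ^ 3) - 1 / (240 * (x + 1) ^ 3) - 1 / (5 * w ^ 2 * (w ^ 2 - 1))
      = ((3 * x * (x + 1) + 1) * w ^ 2 - 12 * (x * (x + 1)) ^ 2) / (240 * (x * (x + 1)) ^ 3 * w ^ 2)"
    unfolding w(2) using assms(1) w(1)
    by (simp add: divide_simps) (simp add: algebra_simps eval_nat_numeral)
  moreover have "(3 * x * (x + 1) + 1) * w ^ 2 - 12 * (x * (x + 1)) ^ 2 = 7 * (x * (x + 1)) + 1"
    by (simp add: w_def algebra_simps eval_nat_numeral)
  moreover have "(7 * (x * (x + 1)) + 1) / (240 * (x * (x + 1)) ^ 3 * w ^ 2) > 0"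
    using assms(1) w(1) by (intro divide_pos_pos mult_pos_pos add_pos_pos zero_less_power) auto
  ultimately show ?thesis
    by simp
qed

text \<open>Both sides are rational functions of v = x (x + 1). The constants 1/240 and 11/6720 make
  their expansions in 1/v agree in the orders v^(-2) and v^(-3); the remaining numerator has only
  positive coefficients.\<close>

lemma quintic_diff_lt:
  fixes x :: real
  assumes "x > 0"
  defines "w \<equiv> 2 * x + 1"
  shows "(1 / (240 * x ^ 3) - 11 / (6720 * x ^ 5)) - (1 / (240 * (x + 1) ^ 3) - 11 / (6720 * (x + 1) ^ 5))
     < 1 / (5 * w ^ 4) + 1 / (7 * w ^ 6)"
proof -
  define v where "v = x * (x + 1)"
  have v: "v > 0"
    using assms(1) by (simp add: v_def)
  have w2: "w ^ 2 = 4 * v + 1"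
    by (simp add: v_def w_def algebra_simps power2_eq_square)
  have cubic: "1 / x ^ 3 - 1 / (x + 1) ^ 3 = (3 * v + 1) / v ^ 3"
    unfolding v_def using assms(1)
    by (simp add: divide_simps) (simp add: algebra_simps eval_nat_numeral)
  have quintic: "1 / x ^ 5 - 1 / (x + 1) ^ 5 = (5 * v ^ 2 + 5 * v + 1) / v ^ 5"
    unfolding v_def using assms(1)
    by (simp add: divide_simps) (simp add: algebra_simps eval_nat_numeral)
  have lhs: "(1 / (240 * x ^ 3) - 11 / (6720 * x ^ 5)) - (1 / (240 * (x + 1) ^ 3) - 11 / (6720 * (x + 1) ^ 5))
     = (3 * v + 1) / v ^ 3 / 240 - (5 * v ^ 2 + 5 * v + 1) / v ^ 5 * (11 / 6720)"
    unfolding cubic[symmetric] quintic[symmetric] by (simp add: field_simps)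
  have "w ^ 4 = (4 * v + 1) ^ 2" "w ^ 6 = (4 * v + 1) ^ 3"
    unfolding w2[symmetric] by (simp_all flip: power_mult)
  then have rhs: "1 / (5 * w ^ 4) + 1 / (7 * w ^ 6) = 1 / (5 * (4 * v + 1) ^ 2) + 1 / (7 * (4 * v + 1) ^ 3)"
    by simp
  have "1 / (5 * (4 * v + 1) ^ 2) + 1 / (7 * (4 * v + 1) ^ 3)
      - ((3 * v + 1) / v ^ 3 / 240 - (5 * v ^ 2 + 5 * v + 1) / v ^ 5 * (11 / 6720))
      = (3808 * v ^ 4 + 3584 * v ^ 3 + 1215 * v ^ 2 + 187 * v + 11) / (6720 * v ^ 5 * (4 * v + 1) ^ 3)"
    using v add_pos_pos[of "4 * v" 1]
    by (simp add: divide_simps) (simp add: algebra_simps eval_nat_numeral)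
  moreover have "\<dots> > 0"
    using v by (intro divide_pos_pos add_pos_pos mult_pos_pos zero_less_power) auto
  ultimately show ?thesis
    unfolding lhs rhs by linarith
qed

section \<open>Limits: the tri-gamma function and Stirling's constant\<close>

text \<open>By the recurrence, the value at n + 1/2 is a tail of the convergent series for
  \<open>Polygamma 1 (1 / 2)\<close>.\<close>

lemma Trigamma_half_tendsto_0: "(\<lambda>n. Polygamma 1 (real n + 1 / 2)) \<longlonglongrightarrow> 0"
proof -
  have "Polygamma 1 (real n + 1 / 2) = Polygamma 1 (1 / 2) - (\<Sum>k<n. inverse ((1 / 2 + real k) ^ 2))" for n
  proof (induction n)
    case (Suc n)
    have "Polygamma 1 ((real n + 1 / 2) + 1) = Polygamma 1 (real n + 1 / 2) - 1 / (real n + 1 / 2) ^ 2"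
      by (subst Polygamma_plus1) (auto simp: eval_nat_numeral)
    moreover have "real (Suc n) + 1 / 2 = real n + 1 / 2 + 1"
      by simp
    ultimately show ?case
      using Suc by (simp add: add.commute inverse_eq_divide)
  qed simp
  moreover have "(\<lambda>n. \<Sum>k<n. inverse ((1 / 2 + real k) ^ 2)) \<longlonglongrightarrow> Polygamma 1 (1 / 2)"
    using Polygamma_LIMSEQ[of "1 / 2 :: real" 1] by (simp add: sums_def eval_nat_numeral)
  then have "(\<lambda>n. Polygamma 1 (1 / 2) - (\<Sum>k<n. inverse ((1 / 2 + real k) ^ 2)))
      \<longlonglongrightarrow> Polygamma 1 (1 / 2) - Polygamma 1 (1 / 2)"
    by (intro tendsto_intros)
  ultimately show ?thesis
    by simp
qed

text \<open>Expresses the Wallis partial product through factorials, so that its logarithm can be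
  compared with Stirling's formula.\<close>

lemma wallis_product_fact:
  "(\<Prod>k=1..n. (4 * real k ^ 2) / (4 * real k ^ 2 - 1))
     = 16 ^ n * fact n ^ 4 / (fact (2 * n) ^ 2 * (2 * real n + 1))"
proof (induction n)
  case (Suc n)
  have *: "fact (2 * Suc n) = (2 * real n + 2) * (2 * real n + 1) * fact (2 * n)"
    by (simp add: algebra_simps)
  have **: "4 * real (Suc n) ^ 2 - 1 = (2 * real n + 1) * (2 * real n + 3)"
    by (simp add: algebra_simps power2_eq_square)
  have ***: "fact (Suc n) = (real n + 1) * fact n" "real (Suc n) = real n + 1"
    by simp_all
  have "(\<Prod>k=1..Suc n. (4 * real k ^ 2) / (4 * real k ^ 2 - 1))
     = (16 ^ n * fact n ^ 4 / (fact (2 * n) ^ 2 * (2 * real n + 1)))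
       * ((4 * real (Suc n) ^ 2) / (4 * real (Suc n) ^ 2 - 1))"
    using Suc by simp
  also have "\<dots> = 16 ^ Suc n * fact (Suc n) ^ 4 / (fact (2 * Suc n) ^ 2 * (2 * real (Suc n) + 1))"
    unfolding * ** unfolding ***
    by (simp add: divide_simps) (simp add: algebra_simps eval_nat_numeral)
  finally show ?case .
qed simp

text \<open>Stirling's formula says that this tends to \<open>ln (2 * pi) / 2\<close>.\<close>

definition ln_stirling_quotient :: "nat \<Rightarrow> real" where
  "ln_stirling_quotient n = ln (fact n) + real n - (real n + 1 / 2) * ln (real n)"

text \<open>The weights 4 at n and -2 at 2n cancel the linear terms and the multiples of n ln
  n.\<close>

lemma wallis_ln_stirling_quotient:
  assumes "n > 0"
  shows "ln (\<Prod>k=1..n. (4 * real k ^ 2) / (4 * real k ^ 2 - 1))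
    = 4 * ln_stirling_quotient n - 2 * ln_stirling_quotient (2 * n) - ln 2
      + ln (real n / (2 * real n + 1))"
proof -
  have "ln (\<Prod>k=1..n. (4 * real k ^ 2) / (4 * real k ^ 2 - 1))
     = real n * ln 16 + 4 * ln (fact n) - (2 * ln (fact (2 * n)) + ln (2 * real n + 1))"
    unfolding wallis_product_fact
    by (simp add: ln_div ln_mult ln_realpow)
  moreover have "ln (16::real) = 4 * ln 2"
    using ln_realpow[of 2 4] by simp
  ultimately show ?thesis
    using assms by (simp add: ln_stirling_quotient_def ln_div ln_mult algebra_simps)
qed

text \<open>Along n and 2n the limit is the same, so Wallis' product yields 2L - 2 ln 2 = ln (pi /
  2). That a limit exists is shown later, by monotonicity.\<close>

lemma ln_stirling_quotient_limit_unique: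
  assumes "ln_stirling_quotient \<longlonglongrightarrow> L"
  shows "L = ln (2 * pi) / 2"
proof -
  have L2: "(\<lambda>n. ln_stirling_quotient (2 * n)) \<longlonglongrightarrow> L"
    using LIMSEQ_subseq_LIMSEQ[OF assms, of "\<lambda>n. 2 * n"] by (simp add: strict_mono_def o_def)
  have "(\<lambda>n. real n / (2 * real n + 1)) \<longlonglongrightarrow> 1 / 2"
    by real_asymp
  then have "(\<lambda>n. 4 * ln_stirling_quotient n - 2 * ln_stirling_quotient (2 * n) - ln 2
      + ln (real n / (2 * real n + 1))) \<longlonglongrightarrow> 4 * L - 2 * L - ln 2 + ln (1 / 2)"
    by (intro tendsto_add tendsto_diff tendsto_mult tendsto_const tendsto_ln assms L2) auto
  moreover have "(\<lambda>n. ln (\<Prod>k=1..n. (4 * real k ^ 2) / (4 * real k ^ 2 - 1))) \<longlonglongrightarrow> ln (pi / 2)"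
    by (intro tendsto_ln wallis) auto
  then have "(\<lambda>n. 4 * ln_stirling_quotient n - 2 * ln_stirling_quotient (2 * n) - ln 2
      + ln (real n / (2 * real n + 1))) \<longlonglongrightarrow> ln (pi / 2)"
    by (rule Lim_transform_eventually)
       (use eventually_gt_at_top[of 0] in eventually_elim, rule wallis_ln_stirling_quotient)
  ultimately have "4 * L - 2 * L - ln 2 + ln (1 / 2) = ln (pi / 2)"
    by (rule LIMSEQ_unique)
  then show ?thesis
    by (simp add: ln_div ln_mult)
qed

section \<open>The logarithm of the quotient: differences, limit and conclusion\<close>

text \<open>The index is shifted by one because \<open>ln_stirling_quotient 0\<close> is a junk value.\<close>

definition ln_quotient :: "nat \<Rightarrow> real" where
  "ln_quotient n = ln_stirling_quotient (Suc n) - ln (2 * pi) / 2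
     - Polygamma 1 (real (Suc n) + 1 / 2) / 12"

lemma ln_quotient_diff:
  "ln_quotient n - ln_quotient (Suc n)
    = (real (Suc n) + 1 / 2) * (ln (real (Suc n) + 1) - ln (real (Suc n)))
      - 1 - 1 / (3 * (2 * real (Suc n) + 1) ^ 2)"
proof -
  define x where "x = real (Suc n)"
  have x: "x > 0" "real (Suc (Suc n)) = x + 1"
    by (simp_all add: x_def)
  have fact: "ln (fact (Suc (Suc n))) = ln (x + 1) + ln (fact (Suc n) :: real)"
    unfolding fact_Suc[of "Suc n"] using x by (simp add: ln_mult x_def add.commute)
  have "Polygamma 1 ((x + 1 / 2) + 1) = Polygamma 1 (x + 1 / 2) - 1 / (x + 1 / 2) ^ 2"
    using x by (subst Polygamma_plus1) (auto simp: eval_nat_numeral)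
  \<comment> \<open>Written with 12 in the numerator, the correction becomes 1 / (3 w^2) after
    division by 12, with w = 2x + 1; this is exactly the k = 1 term in
    \<open>ln_quotient_bounds\<close>.\<close>
  then have poly: "Polygamma 1 (x + 1 + 1 / 2) = Polygamma 1 (x + 1 / 2) - 12 / (3 * (2 * x + 1) ^ 2)"
    using x(1) by (simp add: add_ac divide_simps power2_eq_square) (simp add: algebra_simps)
  show ?thesis
    unfolding ln_quotient_def ln_stirling_quotient_def fact x(2) x_def[symmetric] poly
    by (simp add: field_simps)
qed

lemma ln_quotient_diff_less:
  "ln_quotient n - ln_quotient (Suc n)
    < 1 / (240 * real (Suc n) ^ 3) - 1 / (240 * real (Suc (Suc n)) ^ 3)"
  using ln_quotient_bounds(2)[of "real (Suc n)"] cube_diff_gt[of "real (Suc n)"]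
  unfolding ln_quotient_diff by (simp add: add_ac)

lemma ln_quotient_diff_greater:
  "(1 / (240 * real (Suc n) ^ 3) - 11 / (6720 * real (Suc n) ^ 5))
     - (1 / (240 * real (Suc (Suc n)) ^ 3) - 11 / (6720 * real (Suc (Suc n)) ^ 5))
   < ln_quotient n - ln_quotient (Suc n)"
  using ln_quotient_bounds(1)[of "real (Suc n)"] quintic_diff_lt[of "real (Suc n)"]
  unfolding ln_quotient_diff by (simp add: add_ac)

text \<open>Passing to the limit only gives \<le>; one further step of the sequence restores
  strictness.\<close>

lemma less_limit_of_strict_increase:
  fixes f :: "nat \<Rightarrow> real"
  assumes "\<And>n. f n < f (Suc n)" and "f \<longlonglongrightarrow> L"
  shows "f n < L"
proof -
  have "incseq f"
    using assms(1) by (intro incseq_SucI less_imp_le)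
  then have "f (Suc n) \<le> L"
    using assms(2) by (rule incseq_le)
  then show ?thesis
    using assms(1)[of n] by simp
qed

text \<open>The sequence decreases, and it is bounded below because subtracting the nonnegative
  \<open>?G\<close> makes it increase. Hence it converges, and Wallis' product then determines the
  limit.\<close>

lemma ln_quotient_tendsto_0: "ln_quotient \<longlonglongrightarrow> 0"
proof -
  let ?G = "\<lambda>n. 1 / (240 * real (Suc n) ^ 3)"
  have dec: "ln_quotient (Suc n) \<le> ln_quotient n" for n
  proof -
    have "0 \<le> 1 / (5 * (2 * real (Suc n) + 1) ^ 4) + 1 / (7 * (2 * real (Suc n) + 1) ^ 6)"
      by simp
    then show ?thesis
      using ln_quotient_bounds(1)[of "real (Suc n)"] ln_quotient_diff[of n] by linarith
  qed
  have "incseq (\<lambda>n. ln_quotient n - ?G n)"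
    using ln_quotient_diff_less by (intro incseq_SucI) (smt (verit))
  then have "ln_quotient n - ?G n \<ge> ln_quotient 0 - ?G 0" for n
    by (auto dest: incseqD)
  moreover have "?G n \<ge> 0" for n
    by simp
  ultimately have bound: "ln_quotient 0 - ?G 0 \<le> ln_quotient n" for n
    by (smt (verit))
  obtain L where L: "ln_quotient \<longlonglongrightarrow> L"
    using decseq_convergent[of ln_quotient] decseq_SucI[of ln_quotient] dec bound by blast
  \<comment> \<open>Adding back the subtracted terms recovers
    \<open>ln_stirling_quotient (Suc n)\<close>, and the tri-gamma term vanishes in the
    limit.\<close>
  have "(\<lambda>n. ln_quotient n + ln (2 * pi) / 2 + Polygamma 1 (real (Suc n) + 1 / 2) / 12)
      \<longlonglongrightarrow> L + ln (2 * pi) / 2 + 0 / 12"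
    by (intro tendsto_intros L LIMSEQ_Suc[OF Trigamma_half_tendsto_0]) auto
  then have "(\<lambda>n. ln_stirling_quotient (Suc n)) \<longlonglongrightarrow> L + ln (2 * pi) / 2"
    by (simp add: ln_quotient_def)
  then have "L + ln (2 * pi) / 2 = ln (2 * pi) / 2"
    by (intro ln_stirling_quotient_limit_unique) (simp only: filterlim_sequentially_Suc)
  with L show ?thesis
    by simp
qed

lemma exp_ln_quotient:
  assumes "n \<ge> 1"
  shows "exp (real n) * fact n /
      (real n ^ n * sqrt (2 * pi * real n) * exp (1 / 12 * Polygamma 1 (real n + 1 / 2)))
    = exp (ln_quotient (n - 1))"
proof -
  have "real n > 0"
    using assms by simp
  have "exp (ln_quotient (n - 1)) = exp (ln (exp (real n) * fact n /
      (real n ^ n * sqrt (2 * pi * real n) * exp (1 / 12 * Polygamma 1 (real n + 1 / 2)))))"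
    using assms by (simp add: ln_quotient_def ln_stirling_quotient_def ln_div ln_mult ln_realpow
      ln_sqrt field_simps)
  also have "\<dots> = exp (real n) * fact n /
      (real n ^ n * sqrt (2 * pi * real n) * exp (1 / 12 * Polygamma 1 (real n + 1 / 2)))"
    using \<open>real n > 0\<close> by (intro exp_ln) simp
  finally show ?thesis ..
qed

theorem theorem2p2:
  fixes n :: nat
  assumes "n \<ge> 1"
  shows "exp (1 / (240 * real n ^ 3) - 11 / (6720 * real n ^ 5))
           < exp (real n) * fact n /
             (real n ^ n * sqrt (2 * pi * real n) * exp (1 / 12 * Polygamma 1 (real n + 1 / 2)))
       \<and> exp (real n) * fact n /
             (real n ^ n * sqrt (2 * pi * real n) * exp (1 / 12 * Polygamma 1 (real n + 1 / 2)))
           < exp (1 / (240 * real n ^ 3))"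
proof -
  let ?G = "\<lambda>m. 1 / (240 * real (Suc m) ^ 3)"
  let ?H = "\<lambda>m. ?G m - 11 / (6720 * real (Suc m) ^ 5)"
  have "?G \<longlonglongrightarrow> 0" "?H \<longlonglongrightarrow> 0"
    by real_asymp+
  then have lim: "(\<lambda>m. ln_quotient m - ?G m) \<longlonglongrightarrow> 0" "(\<lambda>m. ?H m - ln_quotient m) \<longlonglongrightarrow> 0"
    using tendsto_diff[OF ln_quotient_tendsto_0, of ?G 0] tendsto_diff[OF _ ln_quotient_tendsto_0, of ?H 0]
    by simp_all
  have "ln_quotient m - ?G m < ln_quotient (Suc m) - ?G (Suc m)" for m
    using ln_quotient_diff_less[of m] by linarith
  then have "ln_quotient (n - 1) - ?G (n - 1) < 0"
    using lim(1) by (rule less_limit_of_strict_increase)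
  \<comment> \<open>The sign is reversed so that the lower bound, too, concerns a sequence
    increasing to 0.\<close>
  moreover have "?H m - ln_quotient m < ?H (Suc m) - ln_quotient (Suc m)" for m
    using ln_quotient_diff_greater[of m] by linarith
  then have "?H (n - 1) - ln_quotient (n - 1) < 0"
    using lim(2) by (rule less_limit_of_strict_increase)
  ultimately show ?thesis
    unfolding exp_ln_quotient[OF assms] exp_less_cancel_iff using assms by simp
qed

end
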